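(* Let $d\ge 1$, $n\ge1$ and let $Q=(q_\alpha)$ be a $d$-dimensional latin hypercube of order $n$. The following are equivalent: (i) the filling of every bundle uniquely determines the filling of the subcube of order $2$ it spans; that is, whenever $(\alpha^0,\ldots,\alpha^d)$ and $(\beta^0,\ldots,\beta^d)$ are bundles with $q_{\alpha^i}=q_{\beta^i}$ for all $i=0,\ldots,d$, one has $q_{\alpha(\varepsilon)}=q_{\beta(\varepsilon)}$ for every $\varepsilon\in\{0,1\}^d$, where $\alpha(\varepsilon)$ is the index with $\alpha(\varepsilon)_i=\alpha^0_i$ if $\varepsilon_i=0$ and $\alpha(\varepsilon)_i=\alpha^i_i$ if $\varepsilon_i=1$ (and similarly for $\beta(\varepsilon)$); (ii) for every pair of directions $1\le i<j\le d$ there is a latin square $L^{i,j}$ of order $n$ which is isotopic to the Cayley table of some group, such that every $2$-dimensional plane of $Q$ of direction $(i,j)$ is principally isotopic to $L^{i,j}$.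
   Context: A $d$-dimensional latin hypercube of order $n$ is an array $Q=(q_\alpha)$ indexed by $\alpha=(\alpha_1,\ldots,\alpha_d)\in\{0,\ldots,n-1\}^d$, with entries in $\{0,\ldots,n-1\}$, such that in each line all symbols are different; a line of direction $(i)$ is a set of indices obtained by letting coordinate $i$ range over $\{0,\ldots,n-1\}$ with all other coordinates fixed. A $2$-dimensional plane of direction $(i,j)$, $i<j$, is the $n\times n$ latin square obtained by letting coordinates $i$ and $j$ vary (indexing rows by coordinate $i$ and columns by coordinate $j$) with all other coordinates fixed. A bundle in $Q$ is a tuple of indices $(\alpha^0,\alpha^1,\ldots,\alpha^d)$ such that for each $i\in\{1,\ldots,d\}$ the indices $\alpha^0$ and $\alpha^i$ lie in a common line of direction $(i)$ (i.e. they agree in all coordinates other than $i$); its filling is $(q_{\alpha^0},\ldots,q_{\alpha^d})$. The subcube of order $2$ spanned by the bundle is the set of indices $\beta$ such that for every $i$, $\beta_i\in\{\alpha^0_i,\alpha^i_i\}$. Two latin squares are isotopic if one is obtained from the other by permuting rows, columns and symbols; principally isotopic if by permuting rows and columns only. A latin square is isotopic to the Cayley table of a group if it is isotopic to the multiplication table of some group of order $n$ with elements labelled $0,\ldots,n-1$. *)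

theory Defs
  imports "HOL-Library.FuncSet" "HOL-Combinatorics.Permutations" "HOL-Algebra.Group"
begin

text \<open>
  Coordinates are numbered from \<open>1\<close> to \<open>d\<close>. An index is an extensional function, so that two
  indices are equal if and only if they agree in the coordinates \<open>1, \<dots>, d\<close>.
\<close>

definition indices :: "nat \<Rightarrow> nat \<Rightarrow> (nat \<Rightarrow> nat) set" where
  "indices d n = {1..d} \<rightarrow>\<^sub>E {0..<n}"

definition lines :: "nat \<Rightarrow> nat \<Rightarrow> nat \<Rightarrow> (nat \<Rightarrow> nat) set set" where
  "lines d n i = {{\<alpha>(i := x) | x. x \<in> {0..<n}} | \<alpha>. \<alpha> \<in> indices d n}"

definition latin_hypercube :: "nat \<Rightarrow> nat \<Rightarrow> ((nat \<Rightarrow> nat) \<Rightarrow> nat) \<Rightarrow> bool" where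
  "latin_hypercube d n Q \<longleftrightarrow>
     (\<forall>\<alpha>\<in>indices d n. Q \<alpha> \<in> {0..<n}) \<and>
     (\<forall>i\<in>{1..d}. \<forall>l\<in>lines d n i. inj_on Q l)"

text \<open>
  A tuple \<open>(\<alpha>\<^sup>0, \<dots>, \<alpha>\<^sup>d)\<close> of indices is a function on the natural numbers of which only
  the values at \<open>0, \<dots>, d\<close> are used. Degenerate bundles (with \<open>\<alpha>\<^sup>i = \<alpha>\<^sup>0\<close> for some \<open>i\<close>) are allowed.
\<close>

definition is_bundle :: "nat \<Rightarrow> nat \<Rightarrow> (nat \<Rightarrow> nat \<Rightarrow> nat) \<Rightarrow> bool" where
  "is_bundle d n \<alpha> \<longleftrightarrow>
     (\<forall>i\<in>{0..d}. \<alpha> i \<in> indices d n) \<and>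
     (\<forall>i\<in>{1..d}. \<exists>l\<in>lines d n i. \<alpha> 0 \<in> l \<and> \<alpha> i \<in> l)"

definition subcube_index :: "nat \<Rightarrow> (nat \<Rightarrow> nat \<Rightarrow> nat) \<Rightarrow> (nat \<Rightarrow> nat) \<Rightarrow> nat \<Rightarrow> nat" where
  "subcube_index d \<alpha> \<epsilon> = (\<lambda>i\<in>{1..d}. if \<epsilon> i = 0 then \<alpha> 0 i else \<alpha> i i)"

definition bundles_determine_subcubes :: "nat \<Rightarrow> nat \<Rightarrow> ((nat \<Rightarrow> nat) \<Rightarrow> nat) \<Rightarrow> bool" where
  "bundles_determine_subcubes d n Q \<longleftrightarrow>
     (\<forall>\<alpha> \<beta>. is_bundle d n \<alpha> \<and> is_bundle d n \<beta> \<and> (\<forall>i\<in>{0..d}. Q (\<alpha> i) = Q (\<beta> i)) \<longrightarrow>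
        (\<forall>\<epsilon>\<in>{1..d} \<rightarrow>\<^sub>E {0, 1}. Q (subcube_index d \<alpha> \<epsilon>) = Q (subcube_index d \<beta> \<epsilon>)))"

text \<open>
  Square arrays of order \<open>n\<close> are binary functions (row, then column) of which only the values at
  arguments below \<open>n\<close> are used.
\<close>

definition latin_square :: "nat \<Rightarrow> (nat \<Rightarrow> nat \<Rightarrow> nat) \<Rightarrow> bool" where
  "latin_square n L \<longleftrightarrow>
     (\<forall>r\<in>{0..<n}. \<forall>c\<in>{0..<n}. L r c \<in> {0..<n}) \<and>
     (\<forall>r\<in>{0..<n}. inj_on (\<lambda>c. L r c) {0..<n}) \<and>
     (\<forall>c\<in>{0..<n}. inj_on (\<lambda>r. L r c) {0..<n})"

definition isotopic :: "nat \<Rightarrow> (nat \<Rightarrow> nat \<Rightarrow> nat) \<Rightarrow> (nat \<Rightarrow> nat \<Rightarrow> nat) \<Rightarrow> bool" where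
  "isotopic n L M \<longleftrightarrow>
     (\<exists>\<rho> \<gamma> \<sigma>. \<rho> permutes {0..<n} \<and> \<gamma> permutes {0..<n} \<and> \<sigma> permutes {0..<n} \<and>
        (\<forall>r\<in>{0..<n}. \<forall>c\<in>{0..<n}. M (\<rho> r) (\<gamma> c) = \<sigma> (L r c)))"

definition principally_isotopic :: "nat \<Rightarrow> (nat \<Rightarrow> nat \<Rightarrow> nat) \<Rightarrow> (nat \<Rightarrow> nat \<Rightarrow> nat) \<Rightarrow> bool" where
  "principally_isotopic n L M \<longleftrightarrow>
     (\<exists>\<rho> \<gamma>. \<rho> permutes {0..<n} \<and> \<gamma> permutes {0..<n} \<and>
        (\<forall>r\<in>{0..<n}. \<forall>c\<in>{0..<n}. M (\<rho> r) (\<gamma> c) = L r c))"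

definition isotopic_to_group :: "nat \<Rightarrow> (nat \<Rightarrow> nat \<Rightarrow> nat) \<Rightarrow> bool" where
  "isotopic_to_group n L \<longleftrightarrow>
     (\<exists>G :: nat monoid. group G \<and> carrier G = {0..<n} \<and> isotopic n L (\<lambda>r c. r \<otimes>\<^bsub>G\<^esub> c))"

text \<open>
  The plane of direction \<open>(i, j)\<close> through the index \<open>\<alpha>\<close>; it does not depend on the
  coordinates \<open>i\<close> and \<open>j\<close> of \<open>\<alpha>\<close>.
\<close>

definition plane ::
  "((nat \<Rightarrow> nat) \<Rightarrow> nat) \<Rightarrow> nat \<Rightarrow> nat \<Rightarrow> (nat \<Rightarrow> nat) \<Rightarrow> nat \<Rightarrow> nat \<Rightarrow> nat" where
  "plane Q i j \<alpha> = (\<lambda>r c. Q (\<alpha>(i := r, j := c)))"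

end

theory Submission
  imports Defs
begin

text \<open>
  Both conditions say that any two planes of the same direction jointly satisfy the quadrangle
  criterion: three cells of a rectangle determine the fourth one, uniformly over all these planes.
  For a bundle with all but two edges degenerate this is condition (i), and conversely the filling
  of a subcube is recovered from the bundle by induction on the number of coordinates changed, each
  step completing a rectangle in a plane. Within one plane the criterion is the classical
  characterisation of the latin squares isotopic to groups; between two planes it yields a principal
  isotopy, because matching a row and a column that meet in the same symbol matches all cells.
\<close>

text \<open>For \<open>P = P'\<close> this is the classical quadrangle criterion. Two arrays are
  allowed because planes of the same direction have to be compared with each other. Degenerate
  rectangles are included, to match degenerate bundles.\<close>

definition quadrangle :: "nat \<Rightarrow> (nat \<Rightarrow> nat \<Rightarrow> nat) \<Rightarrow> (nat \<Rightarrow> nat \<Rightarrow> nat) \<Rightarrow> bool" where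
  "quadrangle n P P' \<longleftrightarrow>
     (\<forall>r<n. \<forall>c<n. \<forall>s<n. \<forall>t<n. \<forall>r'<n. \<forall>c'<n. \<forall>s'<n. \<forall>t'<n.
        P r c = P' r' c' \<longrightarrow> P s c = P' s' c' \<longrightarrow> P r t = P' r' t' \<longrightarrow> P s t = P' s' t')"

lemma quadrangleD:
  assumes "quadrangle n P P'" "P r c = P' r' c'" "P s c = P' s' c'" "P r t = P' r' t'"
    and "r < n" "c < n" "s < n" "t < n" "r' < n" "c' < n" "s' < n" "t' < n"
  shows "P s t = P' s' t'"
  by (rule assms(1)[unfolded quadrangle_def, rule_format, of r c s t r' c' s' t']) fact+

subsection \<open>Latin squares and the quadrangle criterion\<close>

lemma bij_betw_lessThan_if_inj_on:
  fixes f :: "nat \<Rightarrow> nat"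
  assumes "inj_on f {0..<n}" "\<And>x. x < n \<Longrightarrow> f x < n"
  shows "bij_betw f {0..<n} {0..<n}"
proof -
  have "f ` {0..<n} = {0..<n}"
    by (rule endo_inj_surj) (use assms in auto)
  with assms(1) show ?thesis by (simp add: bij_betw_def)
qed

lemma latin_square_less: "latin_square n L \<Longrightarrow> r < n \<Longrightarrow> c < n \<Longrightarrow> L r c < n"
  by (simp add: latin_square_def)

lemma latin_square_bij_row:
  "latin_square n L \<Longrightarrow> r < n \<Longrightarrow> bij_betw (L r) {0..<n} {0..<n}"
  by (rule bij_betw_lessThan_if_inj_on) (auto simp: latin_square_def)

lemma latin_square_bij_col:
  "latin_square n L \<Longrightarrow> c < n \<Longrightarrow> bij_betw (\<lambda>r. L r c) {0..<n} {0..<n}"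
  by (rule bij_betw_lessThan_if_inj_on) (auto simp: latin_square_def)

lemma bij_betw_lessThan_ex:
  fixes f :: "nat \<Rightarrow> nat"
  assumes "bij_betw f {0..<n} {0..<n}" "y < n"
  shows "\<exists>x<n. f x = y"
proof -
  have "y \<in> f ` {0..<n}" using assms by (simp add: bij_betw_imp_surj_on)
  then show ?thesis by auto
qed

lemma permutes_restrict_if_bij_betw:
  assumes "bij_betw f A A"
  shows "(\<lambda>x. if x \<in> A then f x else x) permutes A"
proof (rule bij_imp_permutes)
  show "bij_betw (\<lambda>x. if x \<in> A then f x else x) A A"
    using assms by (simp cong: bij_betw_cong)
qed simp

section \<open>From the quadrangle criterion to isotopies\<close>

lemma principally_isotopic_if_quadrangle:
  assumes P: "latin_square n P" and L: "latin_square n L" and q: "quadrangle n P L" and "n \<ge> 1"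
  shows "principally_isotopic n P L"
proof -
  have "0 < n" using \<open>n \<ge> 1\<close> by simp
  \<comment> \<open>Row 0 and column \<open>c0\<close> of \<open>L\<close> cross in the same symbol
    as row 0 and column 0 of \<open>P\<close>, which gives the common corner of all rectangles
    compared below.\<close>
  obtain c0 where c0: "c0 < n" "L 0 c0 = P 0 0"
    using bij_betw_lessThan_ex[OF latin_square_bij_row[OF L \<open>0 < n\<close>]
        latin_square_less[OF P \<open>0 < n\<close> \<open>0 < n\<close>]] by blast
  define row where "row = inv_into {0..<n} (\<lambda>r. L r c0)"
  define col where "col = inv_into {0..<n} (L 0)"
  note bL = latin_square_bij_col[OF L c0(1)] latin_square_bij_row[OF L \<open>0 < n\<close>]
  note bP = latin_square_bij_col[OF P \<open>0 < n\<close>] latin_square_bij_row[OF P \<open>0 < n\<close>]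
  have row: "L (row x) c0 = x" "row x < n" if "x < n" for x
    using that bij_betw_inv_into_right[OF bL(1)] bij_betwE[OF bij_betw_inv_into[OF bL(1)]]
    by (auto simp: row_def)
  have col: "L 0 (col x) = x" "col x < n" if "x < n" for x
    using that bij_betw_inv_into_right[OF bL(2)] bij_betwE[OF bij_betw_inv_into[OF bL(2)]]
    by (auto simp: col_def)
  \<comment> \<open>A row of \<open>P\<close> goes to the row of \<open>L\<close> with the same
    symbol in the reference column, a column to the one with the same symbol in row 0. Outside the
    range both maps are the identity, as \<open>permutes\<close> demands.\<close>
  define \<rho> where "\<rho> = (\<lambda>x. if x \<in> {0..<n} then row (P x 0) else x)"
  define \<gamma> where "\<gamma> = (\<lambda>x. if x \<in> {0..<n} then col (P 0 x) else x)"
  have "\<rho> permutes {0..<n}"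
    unfolding \<rho>_def
    using bij_betw_trans[OF bP(1) bij_betw_inv_into[OF bL(1)]]
    by (intro permutes_restrict_if_bij_betw) (simp add: row_def comp_def)
  moreover have "\<gamma> permutes {0..<n}"
    unfolding \<gamma>_def
    using bij_betw_trans[OF bP(2) bij_betw_inv_into[OF bL(2)]]
    by (intro permutes_restrict_if_bij_betw) (simp add: col_def comp_def)
  moreover have "L (\<rho> r) (\<gamma> c) = P r c" if "r < n" "c < n" for r c
  proof -
    have "P r 0 < n" "P 0 c < n"
      using latin_square_less[OF P] that \<open>0 < n\<close> by auto
    \<comment> \<open>The corners (0,0), (r,0), (0,c) of \<open>P\<close> carry the same symbols as
      their images in \<open>L\<close>, by the choice of \<open>c0\<close>, \<open>row\<close> and
      \<open>col\<close>. So the fourth corners agree.\<close>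
    then have "P r c = L (row (P r 0)) (col (P 0 c))"
      using c0 that \<open>0 < n\<close>
      by - (rule quadrangleD[OF q, of 0 0 0 c0], simp_all add: row col)
    then show ?thesis using that by (simp add: \<rho>_def \<gamma>_def)
  qed
  ultimately show ?thesis unfolding principally_isotopic_def by (intro exI[of _ \<rho>] exI[of _ \<gamma>] conjI) auto
qed

text \<open>Labelling each row by its entry in column 0 and each column by its entry in row 0 turns
  \<open>L\<close> into the table of a loop with identity \<open>L 0 0\<close> (a principal loop
  isotope). The criterion supplies associativity.\<close>

lemma isotopic_to_group_if_quadrangle:
  assumes L: "latin_square n L" and q: "quadrangle n L L" and "n \<ge> 1"
  shows "isotopic_to_group n L"
proof -
  have n: "0 < n" using \<open>n \<ge> 1\<close> by simp
  note b = latin_square_bij_col[OF L n] latin_square_bij_row[OF L n]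
  define R where "R = inv_into {0..<n} (\<lambda>r. L r 0)"
  define C where "C = inv_into {0..<n} (L 0)"
  have R: "L (R x) 0 = x" "R x < n" if "x < n" for x
    using that bij_betw_inv_into_right[OF b(1)] bij_betwE[OF bij_betw_inv_into[OF b(1)]]
    by (auto simp: R_def)
  have C: "L 0 (C x) = x" "C x < n" if "x < n" for x
    using that bij_betw_inv_into_right[OF b(2)] bij_betwE[OF bij_betw_inv_into[OF b(2)]]
    by (auto simp: C_def)
  have RL: "R (L r 0) = r" if "r < n" for r
    using that bij_betw_inv_into_left[OF b(1)] by (simp add: R_def)
  have CL: "C (L 0 c) = c" if "c < n" for c
    using that bij_betw_inv_into_left[OF b(2)] by (simp add: C_def)
  note less = latin_square_less[OF L]
  define G where
    "G = \<lparr>carrier = {0..<n}, mult = (\<lambda>x y. L (R x) (C y)), one = L 0 0\<rparr>"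
  have "group G"
  proof (rule groupI)
    fix x y assume "x \<in> carrier G" "y \<in> carrier G"
    then show "x \<otimes>\<^bsub>G\<^esub> y \<in> carrier G" by (simp add: G_def R C less)
  next
    show "\<one>\<^bsub>G\<^esub> \<in> carrier G" using n less by (simp add: G_def)
  next
    fix x y z assume "x \<in> carrier G" "y \<in> carrier G" "z \<in> carrier G"
    then have xyz: "x < n" "y < n" "z < n" by (simp_all add: G_def)
    \<comment> \<open>Both triple products complete a rectangle whose other corners carry
      \<open>y\<close>, \<open>x \<otimes> y\<close> and \<open>y \<otimes> z\<close>.\<close>
    have "L (R (L (R x) (C y))) (C z) = L (R x) (C (L (R y) (C z)))"
      using xyz n by - (rule quadrangleD[OF q, of "R y" 0 0 "C y"], simp_all add: R C less)
    then show "x \<otimes>\<^bsub>G\<^esub> y \<otimes>\<^bsub>G\<^esub> z = x \<otimes>\<^bsub>G\<^esub> (y \<otimes>\<^bsub>G\<^esub> z)" by (simp add: G_def)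
  next
    fix x assume "x \<in> carrier G"
    then show "\<one>\<^bsub>G\<^esub> \<otimes>\<^bsub>G\<^esub> x = x" using n by (simp add: G_def RL C)
  next
    fix x assume "x \<in> carrier G"
    then have x: "x < n" by (simp add: G_def)
    \<comment> \<open>In the column labelled \<open>x\<close>, the row \<open>r\<close> holds the
      identity symbol; its label \<open>L r 0\<close> is the left inverse of
      \<open>x\<close>.\<close>
    obtain r where r: "r < n" "L r (C x) = L 0 0"
      using bij_betw_lessThan_ex[OF latin_square_bij_col[OF L C(2)[OF x]] less[OF n n]] by blast
    then show "\<exists>y\<in>carrier G. y \<otimes>\<^bsub>G\<^esub> x = \<one>\<^bsub>G\<^esub>"
      using n by (intro bexI[of _ "L r 0"]) (simp_all add: G_def RL less)
  qed
  \<comment> \<open>Rows and columns are sent to their labels; the symbols stay fixed.\<close>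
  moreover have "isotopic n L (\<lambda>r c. r \<otimes>\<^bsub>G\<^esub> c)"
    unfolding isotopic_def
  proof (intro exI conjI ballI)
    show "(\<lambda>r. if r \<in> {0..<n} then L r 0 else r) permutes {0..<n}"
      "(\<lambda>c. if c \<in> {0..<n} then L 0 c else c) permutes {0..<n}"
      using permutes_restrict_if_bij_betw[OF b(1)] permutes_restrict_if_bij_betw[OF b(2)] .
    show "id permutes {0..<n}" by (rule permutes_id)
    fix r c assume "r \<in> {0..<n}" "c \<in> {0..<n}"
    then show "(if r \<in> {0..<n} then L r 0 else r) \<otimes>\<^bsub>G\<^esub> (if c \<in> {0..<n} then L 0 c else c)
        = id (L r c)"
      by (simp add: G_def RL CL)
  qed
  ultimately show ?thesis
    unfolding isotopic_to_group_def by (intro exI[of _ G]) (simp add: G_def)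
qed

section \<open>From isotopies back to the quadrangle criterion\<close>

lemma (in group) mult_rectangle:
  assumes "r \<in> carrier G" "c \<in> carrier G" "s \<in> carrier G" "t \<in> carrier G"
  shows "s \<otimes> t = (s \<otimes> c) \<otimes> (inv (r \<otimes> c) \<otimes> (r \<otimes> t))"
proof -
  have cancel: "inv x \<otimes> (x \<otimes> y) = y" "x \<otimes> (inv x \<otimes> y) = y"
    if "x \<in> carrier G" "y \<in> carrier G" for x y
    using that by (simp_all flip: m_assoc)
  show ?thesis using assms by (simp add: inv_mult_group m_assoc cancel)
qed

text \<open>By \<open>mult_rectangle\<close> the fourth corner in a group table is a fixed word in
  the symbols of the other three, independent of their position. Injectivity of \<sigma> carries
  this back to \<open>L\<close>.\<close>

lemma quadrangle_if_isotopic_to_group: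
  assumes "isotopic_to_group n L"
  shows "quadrangle n L L"
proof -
  from assms obtain G :: "nat monoid" and \<rho> \<gamma> \<sigma>
    where G: "group G" "carrier G = {0..<n}"
      and p: "\<rho> permutes {0..<n}" "\<gamma> permutes {0..<n}" "\<sigma> permutes {0..<n}"
      and iso: "\<And>r c. r < n \<Longrightarrow> c < n \<Longrightarrow> \<rho> r \<otimes>\<^bsub>G\<^esub> \<gamma> c = \<sigma> (L r c)"
    unfolding isotopic_to_group_def isotopic_def by auto
  interpret group G by fact
  have car: "\<rho> r \<in> carrier G" "\<gamma> r \<in> carrier G" if "r < n" for r
    using that permutes_in_image[OF p(1)] permutes_in_image[OF p(2)] by (simp_all add: G)
  have fourth: "\<sigma> (L s t) = \<sigma> (L s c) \<otimes>\<^bsub>G\<^esub> (inv\<^bsub>G\<^esub> \<sigma> (L r c) \<otimes>\<^bsub>G\<^esub> \<sigma> (L r t))"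
    if "r < n" "c < n" "s < n" "t < n" for r c s t
    using mult_rectangle[of "\<rho> r" "\<gamma> c" "\<rho> s" "\<gamma> t"] that by (simp add: iso car)
  show ?thesis
    unfolding quadrangle_def
  proof (intro allI impI)
    fix r c s t r' c' s' t'
    assume "r < n" "c < n" "s < n" "t < n" "r' < n" "c' < n" "s' < n" "t' < n"
      and "L r c = L r' c'" "L s c = L s' c'" "L r t = L r' t'"
    then have "\<sigma> (L s t) = \<sigma> (L s' t')"
      using fourth[of r c s t] fourth[of r' c' s' t'] by simp
    then show "L s t = L s' t'" using permutes_inj[OF p(3)] by (simp add: inj_eq)
  qed
qed

text \<open>Principal isotopies keep symbols, so matching rectangles of \<open>P\<close> and
  \<open>P'\<close> move to matching rectangles of \<open>L\<close>, where the criterion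
  applies.\<close>

lemma quadrangle_if_principally_isotopic:
  assumes "principally_isotopic n P L" "principally_isotopic n P' L" "quadrangle n L L"
  shows "quadrangle n P P'"
proof -
  from assms(1) obtain \<rho> \<gamma> where p: "\<rho> permutes {0..<n}" "\<gamma> permutes {0..<n}"
    and P: "\<And>r c. r < n \<Longrightarrow> c < n \<Longrightarrow> L (\<rho> r) (\<gamma> c) = P r c"
    unfolding principally_isotopic_def by auto
  from assms(2) obtain \<rho>' \<gamma>' where p': "\<rho>' permutes {0..<n}" "\<gamma>' permutes {0..<n}"
    and P': "\<And>r c. r < n \<Longrightarrow> c < n \<Longrightarrow> L (\<rho>' r) (\<gamma>' c) = P' r c"
    unfolding principally_isotopic_def by auto
  have less: "\<rho> r < n" "\<gamma> r < n" "\<rho>' r < n" "\<gamma>' r < n" if "r < n" for r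
    using that permutes_in_image[OF p(1)] permutes_in_image[OF p(2)]
      permutes_in_image[OF p'(1)] permutes_in_image[OF p'(2)] by simp_all
  show ?thesis
    unfolding quadrangle_def
  proof (intro allI impI)
    fix r c s t r' c' s' t'
    assume "r < n" "c < n" "s < n" "t < n" "r' < n" "c' < n" "s' < n" "t' < n"
      and "P r c = P' r' c'" "P s c = P' s' c'" "P r t = P' r' t'"
    then have "L (\<rho> s) (\<gamma> t) = L (\<rho>' s') (\<gamma>' t')"
      by - (rule quadrangleD[OF assms(3), of "\<rho> r" "\<gamma> c" "\<rho>' r'" "\<gamma>' c'"],
        simp_all add: less P P')
    with \<open>s < n\<close> \<open>t < n\<close> \<open>s' < n\<close> \<open>t' < n\<close> show "P s t = P' s' t'" by (simp add: P P')
  qed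
qed

subsection \<open>Planes, bundles and subcubes of a latin hypercube\<close>

lemma indices_upd: "\<alpha> \<in> indices d n \<Longrightarrow> i \<in> {1..d} \<Longrightarrow> x < n \<Longrightarrow> \<alpha>(i := x) \<in> indices d n"
  by (auto simp: indices_def PiE_iff extensional_def)

lemma indices_less: "\<alpha> \<in> indices d n \<Longrightarrow> i \<in> {1..d} \<Longrightarrow> \<alpha> i < n"
  by (auto simp: indices_def PiE_iff)

text \<open>Any point of a line arises from any other by overwriting coordinate \<open>i\<close>.
  This trades the existence of a line in \<open>is_bundle\<close> for an equation between function
  updates.\<close>

lemma same_line_iff:
  assumes "\<alpha> \<in> indices d n" "\<beta> \<in> indices d n" "i \<in> {1..d}"
  shows "(\<exists>l\<in>lines d n i. \<alpha> \<in> l \<and> \<beta> \<in> l) \<longleftrightarrow> \<beta> = \<alpha>(i := \<beta> i)"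
proof
  assume "\<exists>l\<in>lines d n i. \<alpha> \<in> l \<and> \<beta> \<in> l"
  then show "\<beta> = \<alpha>(i := \<beta> i)" by (auto simp: lines_def)
next
  assume \<beta>: "\<beta> = \<alpha>(i := \<beta> i)"
  \<comment> \<open>Written as an update of itself, \<alpha> is visibly a member of the line through
    \<alpha>.\<close>
  have "\<alpha> = \<alpha>(i := \<alpha> i)" by simp
  with \<beta> indices_less[OF assms(1,3)] indices_less[OF assms(2,3)]
  have "\<alpha> \<in> {\<alpha>(i := x) |x. x \<in> {0..<n}} \<and> \<beta> \<in> {\<alpha>(i := x) |x. x \<in> {0..<n}}"
    unfolding mem_Collect_eq by (metis atLeastLessThan_iff zero_le)
  moreover have "{\<alpha>(i := x) |x. x \<in> {0..<n}} \<in> lines d n i"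
    using assms(1) by (auto simp: lines_def)
  ultimately show "\<exists>l\<in>lines d n i. \<alpha> \<in> l \<and> \<beta> \<in> l" by - (rule bexI)
qed

lemma is_bundle_iff:
  "is_bundle d n \<alpha> \<longleftrightarrow>
     (\<forall>i\<in>{0..d}. \<alpha> i \<in> indices d n) \<and> (\<forall>i\<in>{1..d}. \<alpha> i = (\<alpha> 0)(i := \<alpha> i i))"
  unfolding is_bundle_def
  by (rule conj_cong[OF refl], rule ball_cong[OF refl], rule same_line_iff) auto

lemma bundle_in_indices: "is_bundle d n \<alpha> \<Longrightarrow> i \<le> d \<Longrightarrow> \<alpha> i \<in> indices d n"
  unfolding is_bundle_def by simp

lemma bundle_less: "is_bundle d n \<alpha> \<Longrightarrow> i \<le> d \<Longrightarrow> k \<in> {1..d} \<Longrightarrow> \<alpha> i k < n"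
  by (rule indices_less[OF bundle_in_indices])

lemma bundle_upd_eq: "is_bundle d n \<alpha> \<Longrightarrow> i \<in> {1..d} \<Longrightarrow> (\<alpha> 0)(i := \<alpha> i i) = \<alpha> i"
  unfolding is_bundle_iff by metis

lemma latin_hypercube_inj_line:
  assumes "latin_hypercube d n Q" "\<alpha> \<in> indices d n" "i \<in> {1..d}"
  shows "inj_on (\<lambda>x. Q (\<alpha>(i := x))) {0..<n}"
proof -
  have "{\<alpha>(i := x) |x. x \<in> {0..<n}} \<in> lines d n i"
    using assms(2) by (auto simp: lines_def)
  then have inj: "inj_on Q {\<alpha>(i := x) |x. x \<in> {0..<n}}"
    using assms by (simp add: latin_hypercube_def)
  show ?thesis
  proof (rule inj_onI)
    fix x y assume "x \<in> {0..<n}" "y \<in> {0..<n}" "Q (\<alpha>(i := x)) = Q (\<alpha>(i := y))"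
    then have "\<alpha>(i := x) = \<alpha>(i := y)" by (intro inj_onD[OF inj]) auto
    then show "x = y" by (metis fun_upd_same)
  qed
qed

lemma latin_square_plane:
  assumes Q: "latin_hypercube d n Q" and \<alpha>: "\<alpha> \<in> indices d n"
    and ij: "i \<in> {1..d}" "j \<in> {1..d}" "i \<noteq> j"
  shows "latin_square n (plane Q i j \<alpha>)"
  unfolding latin_square_def
proof (intro conjI ballI)
  fix r c assume "r \<in> {0..<n}" "c \<in> {0..<n}"
  then show "plane Q i j \<alpha> r c \<in> {0..<n}"
    using Q \<alpha> ij by (simp add: plane_def latin_hypercube_def indices_upd)
next
  fix r assume "r \<in> {0..<n}"
  then show "inj_on (\<lambda>c. plane Q i j \<alpha> r c) {0..<n}"
    unfolding plane_def using \<alpha> ij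
    by (intro latin_hypercube_inj_line[OF Q] indices_upd) auto
next
  fix c assume "c \<in> {0..<n}"
  \<comment> \<open>The line lemma needs the varying coordinate \<open>i\<close> updated last,
    whereas \<open>plane\<close> updates it first; the updates commute since \<open>i\<close> and
    \<open>j\<close> differ.\<close>
  then have "inj_on (\<lambda>r. Q (\<alpha>(j := c, i := r))) {0..<n}"
    using \<alpha> ij by (intro latin_hypercube_inj_line[OF Q] indices_upd) auto
  then show "inj_on (\<lambda>r. plane Q i j \<alpha> r c) {0..<n}"
    unfolding plane_def using ij(3) by (simp add: fun_upd_twist)
qed

section \<open>From bundles to planes\<close>

definition corner_bundle ::
  "nat \<Rightarrow> nat \<Rightarrow> (nat \<Rightarrow> nat) \<Rightarrow> nat \<Rightarrow> nat \<Rightarrow> nat \<Rightarrow> nat \<Rightarrow> nat \<Rightarrow> nat \<Rightarrow> nat" where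
  "corner_bundle i j \<alpha> r c s t =
     (\<lambda>k. if k = i then \<alpha>(i := s, j := c) else if k = j then \<alpha>(i := r, j := t)
          else \<alpha>(i := r, j := c))"

text \<open>All edges except those in directions \<open>i\<close> and \<open>j\<close> are
  degenerate, so the filling shows just three corners of a rectangle. Position 0 holds the base
  corner because \<open>i\<close> and \<open>j\<close> are positive.\<close>

lemma is_bundle_corner_bundle:
  assumes "\<alpha> \<in> indices d n" "i \<in> {1..d}" "j \<in> {1..d}" "i \<noteq> j"
    and "r < n" "c < n" "s < n" "t < n"
  shows "is_bundle d n (corner_bundle i j \<alpha> r c s t)"
  unfolding is_bundle_iff
  using assms by (auto simp: corner_bundle_def indices_upd fun_eq_iff)

lemma subcube_index_corner_bundle:
  assumes "\<alpha> \<in> indices d n" "i \<in> {1..d}" "j \<in> {1..d}" "i \<noteq> j"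
  shows "subcube_index d (corner_bundle i j \<alpha> r c s t) (\<lambda>k\<in>{1..d}. if k = i \<or> k = j then 1 else 0)
    = \<alpha>(i := s, j := t)"
  using assms
  by (auto simp: subcube_index_def corner_bundle_def fun_eq_iff indices_def PiE_iff extensional_def)

lemma quadrangle_planes_if_bundles_determine_subcubes:
  assumes det: "bundles_determine_subcubes d n Q"
    and ab: "\<alpha> \<in> indices d n" "\<beta> \<in> indices d n"
    and ij: "i \<in> {1..d}" "j \<in> {1..d}" "i \<noteq> j"
  shows "quadrangle n (plane Q i j \<alpha>) (plane Q i j \<beta>)"
  unfolding quadrangle_def
proof (intro allI impI)
  fix r c s t r' c' s' t'
  assume less: "r < n" "c < n" "s < n" "t < n" "r' < n" "c' < n" "s' < n" "t' < n"
    and eq: "plane Q i j \<alpha> r c = plane Q i j \<beta> r' c'" "plane Q i j \<alpha> s c = plane Q i j \<beta> s' c'"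
      "plane Q i j \<alpha> r t = plane Q i j \<beta> r' t'"
  define A where "A = corner_bundle i j \<alpha> r c s t"
  define B where "B = corner_bundle i j \<beta> r' c' s' t'"
  \<comment> \<open>This vertex changes exactly the coordinates \<open>i\<close> and
    \<open>j\<close>: it is the corner opposite to the base point.\<close>
  define \<epsilon> :: "nat \<Rightarrow> nat" where "\<epsilon> = (\<lambda>k\<in>{1..d}. if k = i \<or> k = j then 1 else 0)"
  have "is_bundle d n A" "is_bundle d n B"
    unfolding A_def B_def using ab ij less by (simp_all add: is_bundle_corner_bundle)
  moreover have "\<forall>k\<in>{0..d}. Q (A k) = Q (B k)"
    using eq by (simp add: A_def B_def corner_bundle_def plane_def)
  moreover have "\<epsilon> \<in> {1..d} \<rightarrow>\<^sub>E {0, 1}" by (simp add: \<epsilon>_def)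
  ultimately have "Q (subcube_index d A \<epsilon>) = Q (subcube_index d B \<epsilon>)"
    using det unfolding bundles_determine_subcubes_def by blast
  then show "plane Q i j \<alpha> s t = plane Q i j \<beta> s' t'"
    unfolding A_def B_def \<epsilon>_def plane_def subcube_index_corner_bundle[OF ab(1) ij]
      subcube_index_corner_bundle[OF ab(2) ij] .
qed

section \<open>From planes to subcubes\<close>

definition subcube_vertex :: "nat \<Rightarrow> (nat \<Rightarrow> nat \<Rightarrow> nat) \<Rightarrow> nat set \<Rightarrow> nat \<Rightarrow> nat" where
  "subcube_vertex d \<alpha> S = (\<lambda>k\<in>{1..d}. if k \<in> S then \<alpha> k k else \<alpha> 0 k)"

text \<open>Naming a vertex by its set of changed coordinates makes induction over proper subsets
  available; the empty set and the singletons give the bundle itself.\<close>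

lemma subcube_index_eq_vertex:
  "subcube_index d \<alpha> \<epsilon> = subcube_vertex d \<alpha> {k \<in> {1..d}. \<epsilon> k \<noteq> 0}"
  by (auto simp: subcube_index_def subcube_vertex_def)

lemma subcube_vertex_in_indices: "is_bundle d n \<alpha> \<Longrightarrow> subcube_vertex d \<alpha> S \<in> indices d n"
  unfolding subcube_vertex_def indices_def restrict_PiE_iff
  using bundle_less[of d n \<alpha>] by simp

lemma subcube_vertex_empty: "is_bundle d n \<alpha> \<Longrightarrow> subcube_vertex d \<alpha> {} = \<alpha> 0"
  using bundle_in_indices[of d n \<alpha> 0]
  by (auto simp: subcube_vertex_def indices_def PiE_iff extensional_restrict)

lemma subcube_vertex_insert:
  "i \<in> {1..d} \<Longrightarrow> subcube_vertex d \<alpha> (insert i S) = (subcube_vertex d \<alpha> S)(i := \<alpha> i i)"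
  by (auto simp: subcube_vertex_def fun_eq_iff)

lemma subcube_vertex_singleton:
  assumes "is_bundle d n \<alpha>" "i \<in> {1..d}"
  shows "subcube_vertex d \<alpha> {i} = \<alpha> i"
  using assms by (simp add: subcube_vertex_insert subcube_vertex_empty bundle_upd_eq)

text \<open>If \<open>S\<close> contains \<open>i < j\<close>, its vertex is the fourth corner of a
  rectangle in the plane of direction \<open>(i, j)\<close> through the vertex of
  \<open>S - {i, j}\<close>; the other corners belong to proper subsets. The two bundles may lead to
  different planes, hence the criterion for pairs of planes.\<close>

lemma subcube_vertex_eq_if_quadrangle:
  assumes quad: "\<And>i j \<alpha> \<beta>. 1 \<le> i \<Longrightarrow> i < j \<Longrightarrow> j \<le> d \<Longrightarrow> \<alpha> \<in> indices d n \<Longrightarrow> \<beta> \<in> indices d n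
      \<Longrightarrow> quadrangle n (plane Q i j \<alpha>) (plane Q i j \<beta>)"
    and bundles: "is_bundle d n \<alpha>" "is_bundle d n \<beta>"
    and eq: "\<And>i. i \<in> {0..d} \<Longrightarrow> Q (\<alpha> i) = Q (\<beta> i)"
    and "finite S" "S \<subseteq> {1..d}"
  shows "Q (subcube_vertex d \<alpha> S) = Q (subcube_vertex d \<beta> S)"
  using \<open>finite S\<close> \<open>S \<subseteq> {1..d}\<close>
proof (induction S rule: finite_psubset_induct)
  case (psubset S)
  consider "S = {}" | i where "S = {i}" | i j where "i \<in> S" "j \<in> S" "i < j"
    by (metis is_singletonI' is_singleton_def linorder_neqE_nat)
  then show ?case
  proof cases
    case 1
    then show ?thesis using bundles eq[of 0] by (simp add: subcube_vertex_empty)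
  next
    case (2 i)
    then show ?thesis
      using bundles eq[of i] psubset.prems by (simp add: subcube_vertex_singleton)
  next
    case (3 i j)
    define T where "T = S - {i, j}"
    have ij: "i \<in> {1..d}" "j \<in> {1..d}" using 3 psubset.prems by auto
    have S: "S = insert j (insert i T)" and T: "i \<notin> T" "j \<notin> T" using 3 by (auto simp: T_def)
    have IH: "Q (subcube_vertex d \<alpha> U) = Q (subcube_vertex d \<beta> U)" if "U \<subset> S" for U
      using psubset that by blast
    \<comment> \<open>Stated for every \<gamma>, so that the same equations place the corners for
      both bundles.\<close>
    have cells:
      "Q (subcube_vertex d \<gamma> T) = plane Q i j (subcube_vertex d \<gamma> T) (\<gamma> 0 i) (\<gamma> 0 j)"
      "Q (subcube_vertex d \<gamma> (insert i T)) = plane Q i j (subcube_vertex d \<gamma> T) (\<gamma> i i) (\<gamma> 0 j)"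
      "Q (subcube_vertex d \<gamma> (insert j T)) = plane Q i j (subcube_vertex d \<gamma> T) (\<gamma> 0 i) (\<gamma> j j)"
      "Q (subcube_vertex d \<gamma> S) = plane Q i j (subcube_vertex d \<gamma> T) (\<gamma> i i) (\<gamma> j j)"
      for \<gamma>
    proof -
      \<comment> \<open>Neither \<open>i\<close> nor \<open>j\<close> lies in \<open>T\<close>, so
        this vertex still has the base coordinates there and is itself a cell of the plane.\<close>
      have "(subcube_vertex d \<gamma> T) i = \<gamma> 0 i" "(subcube_vertex d \<gamma> T) j = \<gamma> 0 j"
        using ij T by (simp_all add: subcube_vertex_def)
      then have [simp]: "(subcube_vertex d \<gamma> T)(i := \<gamma> 0 i) = subcube_vertex d \<gamma> T"
        "(subcube_vertex d \<gamma> T)(j := \<gamma> 0 j) = subcube_vertex d \<gamma> T"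
        "(subcube_vertex d \<gamma> T)(i := x, j := \<gamma> 0 j) = (subcube_vertex d \<gamma> T)(i := x)" for x
        using 3(3) by (auto simp: fun_eq_iff)
      show "Q (subcube_vertex d \<gamma> T) = plane Q i j (subcube_vertex d \<gamma> T) (\<gamma> 0 i) (\<gamma> 0 j)"
        "Q (subcube_vertex d \<gamma> (insert i T)) = plane Q i j (subcube_vertex d \<gamma> T) (\<gamma> i i) (\<gamma> 0 j)"
        "Q (subcube_vertex d \<gamma> (insert j T)) = plane Q i j (subcube_vertex d \<gamma> T) (\<gamma> 0 i) (\<gamma> j j)"
        "Q (subcube_vertex d \<gamma> S) = plane Q i j (subcube_vertex d \<gamma> T) (\<gamma> i i) (\<gamma> j j)"
        using ij by (simp_all add: plane_def S subcube_vertex_insert)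
    qed
    have less: "\<gamma> 0 i < n" "\<gamma> 0 j < n" "\<gamma> i i < n" "\<gamma> j j < n" if "is_bundle d n \<gamma>" for \<gamma>
      using ij by (simp_all add: bundle_less[OF that])
    have quad': "quadrangle n (plane Q i j (subcube_vertex d \<alpha> T))
        (plane Q i j (subcube_vertex d \<beta> T))"
      using ij 3(3) bundles by (intro quad) (auto intro: subcube_vertex_in_indices)
    have "T \<subset> S" "insert i T \<subset> S" "insert j T \<subset> S" using S T 3(3) by auto
    note IH' = IH[OF this(1)] IH[OF this(2)] IH[OF this(3)]
    show ?thesis
      unfolding cells
      by (rule quadrangleD[OF quad' IH'[unfolded cells]])
        (rule less[OF bundles(1)] less[OF bundles(2)])+
  qed
qed

theorem theorem2:
  fixes d n :: nat and Q :: "(nat \<Rightarrow> nat) \<Rightarrow> nat"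
  assumes "d \<ge> 1" and "n \<ge> 1" and "latin_hypercube d n Q"
  shows "bundles_determine_subcubes d n Q \<longleftrightarrow>
    (\<forall>i j. 1 \<le> i \<and> i < j \<and> j \<le> d \<longrightarrow>
      (\<exists>L. latin_square n L \<and> isotopic_to_group n L \<and>
        (\<forall>\<alpha>\<in>indices d n. principally_isotopic n (plane Q i j \<alpha>) L)))"
proof (intro iffI allI impI)
  fix i j assume det: "bundles_determine_subcubes d n Q" and "1 \<le> i \<and> i < j \<and> j \<le> d"
  then have ij: "i \<in> {1..d}" "j \<in> {1..d}" "i \<noteq> j" by auto
  \<comment> \<open>Any fixed plane can serve as \<open>L\<close>; the one through the zero index is
    taken. Comparing it with itself yields the group, comparing the others with it yields the
    principal isotopies.\<close>
  define \<alpha>0 where "\<alpha>0 = (\<lambda>k\<in>{1..d}. 0 :: nat)"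
  have \<alpha>0: "\<alpha>0 \<in> indices d n" using \<open>n \<ge> 1\<close> by (auto simp: \<alpha>0_def indices_def)
  note latin = latin_square_plane[OF assms(3) _ ij]
  note quad = quadrangle_planes_if_bundles_determine_subcubes[OF det _ \<alpha>0 ij]
  show "\<exists>L. latin_square n L \<and> isotopic_to_group n L \<and>
      (\<forall>\<alpha>\<in>indices d n. principally_isotopic n (plane Q i j \<alpha>) L)"
  proof (intro exI conjI ballI)
    show "latin_square n (plane Q i j \<alpha>0)" using latin \<alpha>0 .
    show "isotopic_to_group n (plane Q i j \<alpha>0)"
      using latin[OF \<alpha>0] quad[OF \<alpha>0] \<open>n \<ge> 1\<close> by (rule isotopic_to_group_if_quadrangle)
    show "principally_isotopic n (plane Q i j \<alpha>) (plane Q i j \<alpha>0)" if "\<alpha> \<in> indices d n" for \<alpha>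
      using latin[OF that] latin[OF \<alpha>0] quad[OF that] \<open>n \<ge> 1\<close>
      by (rule principally_isotopic_if_quadrangle)
  qed
next
  assume planes: "\<forall>i j. 1 \<le> i \<and> i < j \<and> j \<le> d \<longrightarrow>
      (\<exists>L. latin_square n L \<and> isotopic_to_group n L \<and>
        (\<forall>\<alpha>\<in>indices d n. principally_isotopic n (plane Q i j \<alpha>) L))"
  \<comment> \<open>Both planes are principally isotopic to the same \<open>L\<close>, which
    satisfies the criterion with itself because it is isotopic to a group.\<close>
  have "quadrangle n (plane Q i j \<alpha>) (plane Q i j \<beta>)"
    if "1 \<le> i" "i < j" "j \<le> d" "\<alpha> \<in> indices d n" "\<beta> \<in> indices d n" for i j \<alpha> \<beta>
    using planes that
    by (meson quadrangle_if_isotopic_to_group quadrangle_if_principally_isotopic)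
  then show "bundles_determine_subcubes d n Q"
    unfolding bundles_determine_subcubes_def subcube_index_eq_vertex
    by (intro allI impI ballI subcube_vertex_eq_if_quadrangle[where n = n]) auto
qed

end
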